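(* Let $H$ be a real Hilbert space, $K\ge 2$, and let $A_1,\dots,A_K\subset H$ be closed convex sets with $A_1\cap\dots\cap A_K=\{0\}$. Let $i(n)\in\{1,\dots,K\}$, $n=1,2,\dots$, be a sequence containing each $k\in\{1,\dots,K\}$ infinitely often, let $x_0\in H$, let $x_n=P_{i(n)}x_{n-1}$ for $n\ge 1$, and let $W$ be the set of all partial weak limits of $\{x_n\}$. Then for each $w\in W$ with $w\neq 0$ there exists another element $w'\in W$ such that: (i) $|J(w')\setminus J(w)|\ge 1$; (ii) $|J(w')\cap J(w)|\ge 2$; (iii) $|J(w')|\ge 3$; (iv) $\langle w'-w,a\rangle\ge 0$ for every $a\in A_{J(w)}$. In particular, $|w'|^2\ge |w|^2+|w-w'|^2$ and $|w'|>|w|$.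
   Context: $\langle\cdot,\cdot\rangle$ and $|\cdot|$ denote the scalar product and the norm of $H$; for a finite set $J$, $|J|$ denotes its cardinality. $P_i$ denotes the metric (nearest point) projection of $H$ onto $A_i$. A partial weak limit of $\{x_n\}$ is the weak limit of some subsequence of $\{x_n\}$. For $J\subset\{1,\dots,K\}$, $A_J=\bigcap_{j\in J}A_j$. For $w\in W$, $J(w)$ is the maximal subset of $\{1,\dots,K\}$ such that $w\in A_{J(w)}$, i.e. $J(w)=\{j: w\in A_j\}$. *)

theory Defs
  imports "HOL-Analysis.Analysis"
begin

text \<open>
  A real Hilbert space is a type of sort \<open>{real_inner, complete_space}\<close>.
\<close>

text \<open>
  The library constant \<open>closest_point\<close> is restricted to Heine-Borel (hence
  finite-dimensional) spaces, so the nearest point map is defined here for arbitrary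
  metric spaces. It is meaningful whenever the nearest point exists and is unique,
  in particular for nonempty closed convex subsets of a Hilbert space.
\<close>

definition metric_proj :: "'a::metric_space set \<Rightarrow> 'a \<Rightarrow> 'a" where
  "metric_proj S x = (THE p. p \<in> S \<and> (\<forall>y\<in>S. dist x p \<le> dist x y))"

text \<open>
  Weak convergence in a Hilbert space; by the Riesz representation theorem the
  continuous linear functionals are exactly the scalar products with a fixed vector.
\<close>

definition weakly_converges :: "(nat \<Rightarrow> 'a::real_inner) \<Rightarrow> 'a \<Rightarrow> bool" where
  "weakly_converges x w \<longleftrightarrow> (\<forall>y. (\<lambda>n. x n \<bullet> y) \<longlonglongrightarrow> w \<bullet> y)"

definition partial_weak_limits :: "(nat \<Rightarrow> 'a::real_inner) \<Rightarrow> 'a set" where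
  "partial_weak_limits x =
     {w. \<exists>r::nat \<Rightarrow> nat. strict_mono r \<and> weakly_converges (x \<circ> r) w}"

text \<open>Only the values \<open>A 1, \<dots>, A K\<close> of the family are relevant.\<close>

definition J_set :: "(nat \<Rightarrow> 'a set) \<Rightarrow> nat \<Rightarrow> 'a \<Rightarrow> nat set" where
  "J_set A K w = {j \<in> {1..K}. w \<in> A j}"

end

theory Submission
  imports Defs "HOL-Complex_Analysis.Great_Picard"
begin

text \<open>
  Projecting onto a convex set never increases the distance to a point \<open>a\<close> of that set, and
  the square of that distance drops at least by the square of the step
  (\<open>metric_proj_fejer\<close>). With \<open>a = 0\<close>, which lies in all the sets, this shows that the norms
  \<open>\<parallel>x n\<parallel>\<close> converge and that the steps \<open>x (Suc n) - x n\<close> tend to zero. Hence \<open>x n\<close>, \<open>x (Suc n)\<close>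
  and \<open>x (n - 1)\<close> have the same weak limits along any sequence of indices \<open>n\<close> tending to infinity,
  and since closed convex sets are weakly closed, a weak limit along such a sequence belongs to
  every set projected onto infinitely often right before, at or right after these indices
  (\<open>eventually_index_in_J_set\<close>).

  Let \<open>w\<close> be the weak limit of \<open>x (r k)\<close>. As \<open>w \<noteq> 0\<close>, some set does not contain \<open>w\<close>, so after time
  \<open>r k\<close> there is a first projection onto a set outside \<open>J w\<close>. Let it happen at time \<open>m k + 1\<close>,
  and let \<open>w'\<close> be a partial weak limit of \<open>x (m k)\<close>.

  \<^item> The set used at time \<open>m k + 1\<close> contributes an element of \<open>J w' - J w\<close>.

  \<^item> For all large \<open>k\<close>, the current set at time \<open>r k\<close> and the next different set both
    have indices in \<open>J w\<close>: by the first paragraph, infinitely many occurrences of an index outside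
    \<open>J w\<close> would put \<open>w\<close> into that set. So from \<open>r k\<close> to \<open>m k\<close> the projections are onto at least two
    different sets. Repeating a projection changes nothing; therefore \<open>x (m k)\<close> is one step away
    from the last point of this period which was obtained with a set other than the one used at
    time \<open>m k\<close>. Both these sets contain \<open>w'\<close>, and their indices lie in \<open>J w\<close>.

  \<^item> Between \<open>r k\<close> and \<open>m k\<close> all projections are onto sets containing the intersection
    \<open>A\<^sub>J\<close> of the sets with index in \<open>J w\<close>. So the distance to any \<open>a \<in> A\<^sub>J\<close> does not increase
    during this period, and as the norms converge, expanding the squares leaves
    \<open>(w' - w) \<bullet> a \<ge> 0\<close> in the limit (\<open>weak_limit_moves_away\<close>). For \<open>a = w\<close> this is the
    inequality between the norms.

  The existence of \<open>w'\<close> is the weak sequential compactness of bounded sets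
  (\<open>bounded_weakly_convergent_subseq\<close>). This fact and the existence of nearest points are both
  consequences of one intersection property of Hilbert spaces,
  \<open>nested_bounded_closed_convex_meet\<close>.
\<close>

section \<open>Nearest points in Hilbert space\<close>

lemma infdist_lessE:
  assumes "S \<noteq> {}" "infdist x S < e"
  obtains z where "z \<in> S" "dist x z < e"
  using cInf_lessD[of "dist x ` S" e] assms infdist_notempty[of S x] by auto

text \<open>
  The distances of \<open>C n\<close> from the origin increase to some \<open>L\<close>. Cutting \<open>C n\<close> with a ball
  whose radius decreases to \<open>L\<close> leaves thin caps, which Cantor's intersection theorem applies to.
\<close>
lemma nested_bounded_closed_convex_meet:
  fixes C :: "nat \<Rightarrow> 'a::{real_inner, complete_space} set"
  assumes closed: "\<And>n. closed (C n)" and convex: "\<And>n. convex (C n)"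
    and nonempty: "\<And>n. C n \<noteq> {}"
    and decreasing: "\<And>m n. m \<le> n \<Longrightarrow> C n \<subseteq> C m"
    and bounded: "bounded (C 0)"
  obtains p where "\<And>n. p \<in> C n"
proof -
  define d where "d n = infdist 0 (C n)" for n
  have d_le: "d n \<le> norm z" if "z \<in> C n" for n z
    using infdist_le[OF that, of 0] by (simp add: d_def)
  obtain B where B: "\<And>z. z \<in> C 0 \<Longrightarrow> norm z \<le> B"
    using bounded by (auto simp: bounded_iff)
  have "d n \<le> B" for n
  proof -
    obtain z where "z \<in> C n" using nonempty[of n] by blast
    then show ?thesis using d_le[of z n] B[of z] decreasing[of 0 n] by force
  qed
  moreover have "incseq d"
    unfolding incseq_def d_def by (auto intro!: infdist_mono decreasing nonempty)
  ultimately obtain L where L: "d \<longlonglongrightarrow> L" and d_le_L: "\<And>n. d n \<le> L"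
    using incseq_convergent[of d B] by blast
  define e where "e n = L + 1 / real (Suc n)" for n
  have e: "e \<longlonglongrightarrow> L"
    unfolding e_def using tendsto_add[OF tendsto_const LIMSEQ_inverse_real_of_nat, of L]
    by (simp add: field_simps)
  define S where "S n = C n \<inter> cball 0 (e n)" for n
  have "S n \<noteq> {}" for n
  proof -
    have "0 < 1 / real (Suc n)" by simp
    then have "d n < e n" using d_le_L[of n] unfolding e_def by linarith
    then obtain z where "z \<in> C n" "dist 0 z < e n"
      using infdist_lessE[OF nonempty] unfolding d_def by metis
    then show ?thesis by (auto simp: S_def)
  qed
  moreover have "closed (S n)" for n by (auto simp: S_def closed)
  moreover have "S n \<subseteq> S m" if "m \<le> n" for m n
  proof -
    have "e n \<le> e m" using that by (simp add: e_def frac_le)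
    then show ?thesis using decreasing[OF that] by (auto simp: S_def)
  qed
  moreover have "\<exists>n. \<forall>y\<in>S n. \<forall>z\<in>S n. dist y z < \<epsilon>" if "\<epsilon> > 0" for \<epsilon>
  proof -
    \<comment> \<open>Midpoints stay in the convex set, hence outside the ball of radius \<open>d n\<close>; the
      parallelogram law turns this into a bound on the diameter of \<open>S n\<close>.\<close>
    have diam: "(dist y z)\<^sup>2 \<le> 4 * (e n)\<^sup>2 - 4 * (d n)\<^sup>2" if "y \<in> S n" "z \<in> S n" for y z n
    proof -
      have "(1/2) *\<^sub>R y + (1/2) *\<^sub>R z \<in> C n"
        using that convexD[OF convex[of n]] by (simp add: S_def)
      then have "d n \<le> norm ((1/2) *\<^sub>R y + (1/2) *\<^sub>R z)" by (rule d_le)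
      also have "\<dots> = norm (y + z) / 2"
        by (simp flip: scaleR_add_right)
      finally have "2 * d n \<le> norm (y + z)" by simp
      moreover have "0 \<le> d n" by (simp add: d_def infdist_nonneg)
      ultimately have "4 * (d n)\<^sup>2 \<le> (norm (y + z))\<^sup>2"
        using power_mono[of "2 * d n" "norm (y + z)" 2] by simp
      moreover have "(norm y)\<^sup>2 \<le> (e n)\<^sup>2" "(norm z)\<^sup>2 \<le> (e n)\<^sup>2"
        using that by (auto simp: S_def intro!: power_mono)
      moreover have "(norm (y - z))\<^sup>2 = 2 * (norm y)\<^sup>2 + 2 * (norm z)\<^sup>2 - (norm (y + z))\<^sup>2"
        by (simp add: power2_norm_eq_inner inner_simps inner_commute)
      ultimately show ?thesis by (simp add: dist_norm)
    qed
    have "(\<lambda>n. 4 * (e n)\<^sup>2 - 4 * (d n)\<^sup>2) \<longlonglongrightarrow> 4 * L\<^sup>2 - 4 * L\<^sup>2"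
      by (intro tendsto_intros e L)
    then have "eventually (\<lambda>n. 4 * (e n)\<^sup>2 - 4 * (d n)\<^sup>2 < \<epsilon>\<^sup>2) sequentially"
      using that by (intro order_tendstoD(2)) auto
    then obtain n where n: "4 * (e n)\<^sup>2 - 4 * (d n)\<^sup>2 < \<epsilon>\<^sup>2"
      using eventually_happens'[OF sequentially_bot] by blast
    have "dist y z < \<epsilon>" if "y \<in> S n" "z \<in> S n" for y z
    proof -
      have "(dist y z)\<^sup>2 < \<epsilon>\<^sup>2" using diam[OF that] n by linarith
      then show ?thesis using \<open>\<epsilon> > 0\<close> by (meson less_imp_le power2_less_imp_less)
    qed
    then show ?thesis by blast
  qed
  ultimately obtain p where "\<And>n. p \<in> S n" using decreasing_closed_nest[of S] by metis
  then show ?thesis using that by (auto simp: S_def)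
qed

text \<open>
  The nearest points form the intersection of \<open>S\<close> with the closed balls around \<open>x\<close> whose radii
  decrease to the distance of \<open>x\<close> from \<open>S\<close>.
\<close>
lemma nearest_point_ex1:
  fixes S :: "'a::{real_inner, complete_space} set"
  assumes S: "closed S" "convex S" "S \<noteq> {}"
  shows "\<exists>!p. p \<in> S \<and> (\<forall>y\<in>S. dist x p \<le> dist x y)"
proof -
  define D where "D n = S \<inter> cball x (infdist x S + 1 / real (Suc n))" for n
  have "D n \<noteq> {}" for n
  proof -
    have "infdist x S < infdist x S + 1 / real (Suc n)" by simp
    then obtain z where "z \<in> S" "dist x z < infdist x S + 1 / real (Suc n)"
      using infdist_lessE[OF S(3)] by metis
    then show ?thesis by (auto simp: D_def)
  qed
  moreover have "closed (D n)" "convex (D n)" for n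
    using S by (auto simp: D_def intro: convex_Int)
  moreover have "D n \<subseteq> D m" if "m \<le> n" for m n
  proof -
    have "1 / real (Suc n) \<le> 1 / real (Suc m)" using that by (simp add: frac_le)
    then show ?thesis by (auto simp: D_def)
  qed
  moreover have "bounded (D 0)"
    unfolding D_def by (rule bounded_subset[OF bounded_cball]) blast
  ultimately obtain p where p: "\<And>n. p \<in> D n"
    using nested_bounded_closed_convex_meet[of D] by metis
  have "dist x p \<le> infdist x S"
  proof (rule LIMSEQ_le_const)
    show "(\<lambda>n. infdist x S + 1 / real (Suc n)) \<longlonglongrightarrow> infdist x S"
      using tendsto_add[OF tendsto_const LIMSEQ_inverse_real_of_nat, of "infdist x S"]
      by (simp add: field_simps)
    show "\<exists>N. \<forall>n\<ge>N. dist x p \<le> infdist x S + 1 / real (Suc n)"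
      using p by (auto simp: D_def)
  qed
  then have nearest: "\<forall>y\<in>S. dist x p \<le> dist x y" by (meson infdist_le order_trans)
  moreover have "p \<in> S" using p by (auto simp: D_def)
  ultimately show ?thesis
    using any_closest_point_unique[OF S(2,1)] by blast
qed

lemma
  fixes S :: "'a::{real_inner, complete_space} set"
  assumes "closed S" "convex S" "S \<noteq> {}"
  shows metric_proj_in: "metric_proj S x \<in> S"
    and metric_proj_nearest: "\<And>y. y \<in> S \<Longrightarrow> dist x (metric_proj S x) \<le> dist x y"
  using theI'[OF nearest_point_ex1[OF assms, of x]] by (auto simp: metric_proj_def)

lemma metric_proj_obtuse:
  fixes S :: "'a::{real_inner, complete_space} set"
  assumes "closed S" "convex S" "y \<in> S"
  shows "(x - metric_proj S x) \<bullet> (y - metric_proj S x) \<le> 0"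
  using assms metric_proj_in[of S x] metric_proj_nearest[of S _ x]
  by (intro any_closest_point_dot[of S]) auto

lemma metric_proj_fixes:
  fixes S :: "'a::{real_inner, complete_space} set"
  assumes "closed S" "convex S" "x \<in> S"
  shows "metric_proj S x = x"
proof -
  have "S \<noteq> {}" using assms(3) by blast
  from metric_proj_nearest[OF assms(1,2) this assms(3), of x] show ?thesis by simp
qed

text \<open>
  The angle at the projection, between \<open>x\<close> and \<open>a\<close>, is obtuse, so Pythagoras' theorem
  becomes an inequality.
\<close>
lemma metric_proj_fejer:
  fixes S :: "'a::{real_inner, complete_space} set"
  assumes "closed S" "convex S" "a \<in> S"
  shows "(norm (metric_proj S x - a))\<^sup>2 + (norm (metric_proj S x - x))\<^sup>2 \<le> (norm (x - a))\<^sup>2"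
  using metric_proj_obtuse[OF assms, of x]
  by (simp add: power2_norm_eq_inner inner_simps inner_commute algebra_simps)

section \<open>Weak convergence in Hilbert space\<close>

text \<open>
  The obtuse angle at the projection \<open>p\<close> of \<open>w\<close> puts \<open>S\<close> into a closed half-space, which excludes
  \<open>w\<close> unless \<open>w = p\<close>; and a closed half-space is preserved by weak limits, being defined by a
  scalar product with a fixed vector.
\<close>
lemma weak_limit_in_closed_convex:
  fixes y :: "nat \<Rightarrow> 'a::{real_inner, complete_space}"
  assumes S: "closed S" "convex S" and w: "weakly_converges y w"
    and freq: "frequently (\<lambda>n. y n \<in> S) sequentially"
  shows "w \<in> S"
proof -
  obtain n where "y n \<in> S" using freq by (auto dest: frequently_ex)
  then have "S \<noteq> {}" by blast
  define p where "p = metric_proj S w"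
  have p: "p \<in> S" unfolding p_def by (rule metric_proj_in) fact+
  have "(\<lambda>n. y n \<bullet> (w - p)) \<longlonglongrightarrow> w \<bullet> (w - p)"
    using w by (simp add: weakly_converges_def)
  from tendsto_diff[OF this tendsto_const[of "p \<bullet> (w - p)"]]
  have lim: "(\<lambda>n. (w - p) \<bullet> (y n - p)) \<longlonglongrightarrow> (norm (w - p))\<^sup>2"
    by (simp add: power2_norm_eq_inner inner_simps inner_commute algebra_simps)
  have "\<not> 0 < (norm (w - p))\<^sup>2"
  proof
    assume "0 < (norm (w - p))\<^sup>2"
    then have "eventually (\<lambda>n. 0 < (w - p) \<bullet> (y n - p)) sequentially"
      using order_tendstoD(1)[OF lim] by blast
    then have "eventually (\<lambda>n. y n \<notin> S) sequentially"
      by eventually_elim (use metric_proj_obtuse[OF S, of _ w] in \<open>force simp: p_def\<close>)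
    then show False using freq by (simp add: frequently_def)
  qed
  then show ?thesis using p by simp
qed

lemma weakly_converges_null_perturbation:
  fixes u :: "nat \<Rightarrow> 'a::real_inner"
  assumes u: "weakly_converges u w" and d: "(\<lambda>n. y n - u n) \<longlonglongrightarrow> 0"
  shows "weakly_converges y w"
  unfolding weakly_converges_def
proof
  fix z
  have "(\<lambda>n. u n \<bullet> z) \<longlonglongrightarrow> w \<bullet> z" using u by (simp add: weakly_converges_def)
  from tendsto_add[OF this tendsto_inner[OF d tendsto_const[of z]]]
  show "(\<lambda>n. y n \<bullet> z) \<longlonglongrightarrow> w \<bullet> z" by (simp add: inner_simps)
qed

lemma weakly_converges_subseq:
  assumes "weakly_converges y w" "filterlim r sequentially sequentially"
  shows "weakly_converges (\<lambda>n. y (r n)) w"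
  unfolding weakly_converges_def
proof
  fix z
  have "(\<lambda>n. y n \<bullet> z) \<longlonglongrightarrow> w \<bullet> z" using assms(1) by (simp add: weakly_converges_def)
  from filterlim_compose[OF this assms(2)] show "(\<lambda>n. y (r n) \<bullet> z) \<longlonglongrightarrow> w \<bullet> z" .
qed

text \<open>
  A common point of the closed convex hulls of the tails of \<open>y\<close> lies in every closed half-space
  that contains a tail. So its scalar products are the limits, which produces the weak limit
  without representing the limit functional by a vector.
\<close>
lemma weakly_converges_if_all_inner_convergent:
  fixes y :: "nat \<Rightarrow> 'a::{real_inner, complete_space}"
  assumes bdd: "bounded (range y)" and conv: "\<And>v. convergent (\<lambda>n. y n \<bullet> v)"
  obtains w where "weakly_converges y w"
proof -
  define C where "C N = closure (convex hull (y ` {N..}))" for N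
  have "C N \<noteq> {}" for N unfolding C_def by auto
  moreover have "closed (C N)" "convex (C N)" for N
    by (auto simp: C_def intro: convex_closure)
  moreover have "C n \<subseteq> C m" if "m \<le> n" for m n
    unfolding C_def by (intro closure_mono hull_mono image_mono) (use that in auto)
  moreover have "bounded (C 0)"
    unfolding C_def by (intro bounded_closure bounded_convex_hull bounded_subset[OF bdd]) auto
  ultimately obtain p where p: "\<And>n. p \<in> C n"
    using nested_bounded_closed_convex_meet[of C] by metis
  have "(\<lambda>n. y n \<bullet> v) \<longlonglongrightarrow> p \<bullet> v" for v
  proof -
    obtain l where l: "(\<lambda>n. y n \<bullet> v) \<longlonglongrightarrow> l" using conv[of v] by (auto simp: convergent_def)
    have "\<bar>p \<bullet> v - l\<bar> \<le> \<epsilon>" if \<epsilon>: "\<epsilon> > 0" for \<epsilon>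
    proof -
      define H where "H = {z. v \<bullet> z \<le> l + \<epsilon>} \<inter> {z. v \<bullet> z \<ge> l - \<epsilon>}"
      obtain N where N: "\<And>n. n \<ge> N \<Longrightarrow> \<bar>y n \<bullet> v - l\<bar> < \<epsilon>"
        using LIMSEQ_D[OF l \<epsilon>] by auto
      have "y n \<in> H" if "n \<ge> N" for n
        using N[OF that] by (auto simp: H_def inner_commute abs_less_iff)
      then have "C N \<subseteq> H"
        unfolding C_def H_def
        by (intro closure_minimal hull_minimal convex_Int convex_halfspace_le
            convex_halfspace_ge closed_Int closed_halfspace_le closed_halfspace_ge) auto
      then show ?thesis using p[of N] by (auto simp: H_def inner_commute abs_le_iff)
    qed
    then have "\<bar>p \<bullet> v - l\<bar> \<le> 0" by (rule field_le_epsilon) auto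
    then show ?thesis using l by simp
  qed
  then show ?thesis using that by (auto simp: weakly_converges_def)
qed

text \<open>
  A diagonal argument makes the scalar products with the countably many terms of the sequence
  converge. The vectors \<open>v\<close> for which \<open>y n \<bullet> v\<close> converges form a closed subspace \<open>V\<close> that contains
  all \<open>y n\<close>. The component of a vector orthogonal to \<open>V\<close> is therefore orthogonal to all \<open>y n\<close> and
  does not affect convergence, so that \<open>V\<close> is the whole space, separable or not.
\<close>
lemma bounded_weakly_convergent_subseq:
  fixes x :: "nat \<Rightarrow> 'a::{real_inner, complete_space}"
  assumes bdd: "bounded (range x)"
  obtains r w where "strict_mono (r :: nat \<Rightarrow> nat)" "weakly_converges (x \<circ> r) w"
proof -
  obtain M where M: "\<And>n. norm (x n) \<le> M" using bdd by (auto simp: bounded_iff)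
  then have "M \<ge> 0" using norm_ge_zero order_trans by blast
  have inner_bdd: "norm (x n \<bullet> z) \<le> M * M" if "z \<in> range x" for n z
    using Cauchy_Schwarz_ineq2[of "x n" z] M that
      mult_mono[of "norm (x n)" M "norm z" M] \<open>M \<ge> 0\<close> by auto
  obtain r where r: "strict_mono (r :: nat \<Rightarrow> nat)"
    and r_conv: "\<And>z. z \<in> range x \<Longrightarrow> \<exists>l. (\<lambda>n. x (r n) \<bullet> z) \<longlonglongrightarrow> l"
    by (rule function_convergent_subsequence[of "range x" "\<lambda>n z. x n \<bullet> z" "M * M"])
      (use inner_bdd in auto)
  define y where "y = x \<circ> r"
  have yM: "norm (y n) \<le> M" for n using M by (simp add: y_def)
  define V where "V = {v. convergent (\<lambda>n. y n \<bullet> v)}"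
  have "subspace V"
    by (auto simp: V_def subspace_def inner_simps convergent_const
        intro: convergent_add convergent_mult[OF convergent_const])
  have "v \<in> V" if v: "v \<in> closure V" for v
  proof -
    have "Cauchy (\<lambda>n. y n \<bullet> v)"
    proof (rule metric_CauchyI)
      fix \<epsilon> :: real assume "\<epsilon> > 0"
      define \<delta> where "\<delta> = \<epsilon> / (3 * (M + 1))"
      have "\<delta> > 0" using \<open>\<epsilon> > 0\<close> \<open>M \<ge> 0\<close> by (simp add: \<delta>_def)
      then obtain v' where v': "v' \<in> V" "dist v' v < \<delta>"
        using v closure_approachable by blast
      have near: "\<bar>y n \<bullet> v - y n \<bullet> v'\<bar> \<le> \<epsilon> / 3" for n
      proof -
        have "\<bar>y n \<bullet> v - y n \<bullet> v'\<bar> \<le> norm (y n) * norm (v - v')"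
          using Cauchy_Schwarz_ineq2[of "y n" "v - v'"] by (simp add: inner_simps)
        also have "\<dots> \<le> (M + 1) * \<delta>"
          using yM[of n] v'(2) \<open>\<delta> > 0\<close> \<open>M \<ge> 0\<close>
          by (intro mult_mono) (auto simp: dist_norm norm_minus_commute)
        also have "\<dots> = \<epsilon> / 3" using \<open>M \<ge> 0\<close> by (simp add: \<delta>_def divide_simps)
        finally show ?thesis .
      qed
      have "Cauchy (\<lambda>n. y n \<bullet> v')" using v'(1) by (auto simp: V_def convergent_Cauchy)
      then obtain N where N: "\<And>m n. m \<ge> N \<Longrightarrow> n \<ge> N \<Longrightarrow> dist (y m \<bullet> v') (y n \<bullet> v') < \<epsilon> / 3"
        using metric_CauchyD[of "\<lambda>n. y n \<bullet> v'" "\<epsilon> / 3"] \<open>\<epsilon> > 0\<close> by auto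
      have "dist (y m \<bullet> v) (y n \<bullet> v) < \<epsilon>" if "m \<ge> N" "n \<ge> N" for m n
        using N[OF that] near[of m] near[of n] unfolding dist_real_def by linarith
      then show "\<exists>N. \<forall>m\<ge>N. \<forall>n\<ge>N. dist (y m \<bullet> v) (y n \<bullet> v) < \<epsilon>" by blast
    qed
    then show ?thesis by (simp add: V_def real_Cauchy_convergent)
  qed
  then have "closed V" by (meson closure_subset_eq subsetI)
  have "y n \<in> V" for n
    using r_conv[of "y n"] by (auto simp: V_def y_def convergent_def)
  have "convergent (\<lambda>n. y n \<bullet> v)" for v
  proof -
    define q where "q = metric_proj V v"
    have V: "closed V" "convex V" "V \<noteq> {}"
      using \<open>closed V\<close> \<open>subspace V\<close> \<open>\<And>n. y n \<in> V\<close> by (auto simp: subspace_imp_convex)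
    have "q \<in> V" unfolding q_def by (rule metric_proj_in[OF V])
    have "y n \<bullet> (v - q) = 0" for n
    proof -
      have "q + y n \<in> V" "q - y n \<in> V"
        using \<open>subspace V\<close> \<open>q \<in> V\<close> \<open>y n \<in> V\<close> by (auto intro: subspace_add subspace_diff)
      from this[THEN metric_proj_obtuse[OF V(1,2), of _ v]] show ?thesis
        by (simp add: q_def[symmetric] inner_commute)
    qed
    then have "y n \<bullet> v = y n \<bullet> q" for n by (simp add: inner_simps)
    then show ?thesis using \<open>q \<in> V\<close> by (simp add: V_def)
  qed
  moreover have "bounded (range y)"
    using yM by (auto simp: bounded_iff)
  ultimately obtain w where "weakly_converges y w"
    using weakly_converges_if_all_inner_convergent by blast
  then show ?thesis using that r by (simp add: y_def)
qed

lemma strict_mono_subseq_of_at_top: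
  fixes g :: "nat \<Rightarrow> nat"
  assumes "filterlim g sequentially sequentially"
  obtains s :: "nat \<Rightarrow> nat" where "strict_mono s" "strict_mono (g \<circ> s)"
proof -
  have "\<exists>n'. n < n' \<and> g n < g n'" for n
  proof -
    have "eventually (\<lambda>n'. n < n' \<and> g n < g n') sequentially"
      using assms eventually_gt_at_top[of n]
      by (intro eventually_conj) (simp_all add: filterlim_at_top Suc_le_eq[symmetric])
    then show ?thesis by (rule eventually_happens'[OF sequentially_bot])
  qed
  then obtain s where "\<And>n. s n < s (Suc n) \<and> g (s n) < g (s (Suc n))"
    using dependent_nat_choice[of "\<lambda>_ _. True" "\<lambda>_ n n'. n < n' \<and> g n < g n'"] by auto
  then show ?thesis using that[of s] by (simp add: strict_mono_Suc_iff)
qed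

lemma partial_weak_limit_along:
  fixes x :: "nat \<Rightarrow> 'a::{real_inner, complete_space}"
  assumes bdd: "bounded (range x)" and m: "filterlim m sequentially sequentially"
  obtains s w where "strict_mono (s :: nat \<Rightarrow> nat)" "weakly_converges (\<lambda>k. x (m (s k))) w"
    "w \<in> partial_weak_limits x"
proof -
  obtain s :: "nat \<Rightarrow> nat" where s: "strict_mono s" "strict_mono (m \<circ> s)"
    by (rule strict_mono_subseq_of_at_top[OF m])
  have "bounded (range (x \<circ> (m \<circ> s)))" by (rule bounded_subset[OF bdd]) auto
  then obtain t w where t: "strict_mono t" "weakly_converges ((x \<circ> (m \<circ> s)) \<circ> t) w"
    using bounded_weakly_convergent_subseq by blast
  have "strict_mono (s \<circ> t)" "strict_mono ((m \<circ> s) \<circ> t)"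
    using s t(1) by (auto intro: strict_mono_o)
  moreover have "weakly_converges (x \<circ> ((m \<circ> s) \<circ> t)) w" using t(2) by (simp add: comp_assoc)
  ultimately show ?thesis
    using that[of "s \<circ> t" w] unfolding partial_weak_limits_def by (auto simp: comp_def)
qed

section \<open>Leaving a set of indices\<close>

text \<open>
  The index sequence stays in \<open>J\<close> from time \<open>n\<close> on until after it has changed at time \<open>q\<close>, and
  leaves \<open>J\<close> later. Then \<open>m\<close> is the last time before leaving, and \<open>p\<close> the last time at which the
  index differs from its final value \<open>i m\<close>.
\<close>
lemma last_change_before_leaving:
  fixes i :: "nat \<Rightarrow> 'b"
  assumes "n < q" "i q \<noteq> i n" "\<And>l. n \<le> l \<Longrightarrow> l \<le> q \<Longrightarrow> i l \<in> J"
    and "q < t" "i t \<notin> J"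
  obtains p m where "n \<le> p" "p < m" "\<forall>l. n \<le> l \<and> l \<le> m \<longrightarrow> i l \<in> J"
    "i (Suc m) \<notin> J" "i p \<noteq> i m" "\<forall>l. p < l \<and> l \<le> m \<longrightarrow> i l = i m"
proof -
  define T where "T = (LEAST t. q < t \<and> i t \<notin> J)"
  have T: "q < T" "i T \<notin> J"
    unfolding T_def using LeastI[of "\<lambda>t. q < t \<and> i t \<notin> J" t] assms by auto
  have before: "i l \<in> J" if "q < l" "l < T" for l
    using not_less_Least[of l "\<lambda>t. q < t \<and> i t \<notin> J"] that by (auto simp: T_def)
  obtain m where m: "T = Suc m" using T(1) by (cases T) auto
  define P where "P p \<longleftrightarrow> n \<le> p \<and> p < m \<and> i p \<noteq> i m" for p
  \<comment> \<open>Since \<open>i n\<close> and \<open>i q\<close> differ, one of them differs from \<open>i m\<close>.\<close>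
  have "\<exists>p. P p"
  proof (cases "i n = i m")
    case True
    then have "q \<noteq> m" using assms(2) by auto
    then have "P q" using T(1) m assms(1,2) True by (auto simp: P_def)
    then show ?thesis ..
  next
    case False
    then have "P n" using T(1) m assms(1) by (auto simp: P_def)
    then show ?thesis ..
  qed
  define p where "p = Greatest P"
  have p: "P p"
    using \<open>\<exists>p. P p\<close> unfolding p_def
    by (rule GreatestI_ex_nat[where b = m]) (auto simp: P_def)
  have after: "i l = i m" if "p < l" "l \<le> m" for l
  proof (rule ccontr)
    assume "i l \<noteq> i m"
    then have "P l" using that p by (cases "l = m") (auto simp: P_def)
    then have "l \<le> p" unfolding p_def by (rule Greatest_le_nat[where b = m]) (auto simp: P_def)
    then show False using that by simp
  qed
  have inside: "i l \<in> J" if "n \<le> l" "l \<le> m" for l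
    using assms(3)[of l] before[of l] that m by (cases "l \<le> q") auto
  show ?thesis
  proof (rule that)
    show "n \<le> p" "p < m" "i p \<noteq> i m" using p by (simp_all add: P_def)
    show "i (Suc m) \<notin> J" using T(2) m by simp
  qed (use after inside in blast)+
qed

section \<open>Sequences of projections\<close>

locale projection_sequence =
  fixes A :: "nat \<Rightarrow> 'h::{real_inner, complete_space} set"
    and K :: nat and i :: "nat \<Rightarrow> nat" and x :: "nat \<Rightarrow> 'h"
  assumes closed_A: "k \<in> {1..K} \<Longrightarrow> closed (A k)"
    and convex_A: "k \<in> {1..K} \<Longrightarrow> convex (A k)"
    and zero_in_A: "k \<in> {1..K} \<Longrightarrow> 0 \<in> A k"
    and i_range: "i (Suc n) \<in> {1..K}"
    and x_step: "x (Suc n) = metric_proj (A (i (Suc n))) (x n)"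
begin

lemma x_in_A: "x (Suc n) \<in> A (i (Suc n))"
proof -
  have "A (i (Suc n)) \<noteq> {}" using zero_in_A[OF i_range, of n] by blast
  from metric_proj_in[OF closed_A[OF i_range] convex_A[OF i_range] this]
  show ?thesis unfolding x_step .
qed

lemma fejer:
  assumes "a \<in> A (i (Suc n))"
  shows "(norm (x (Suc n) - a))\<^sup>2 + (norm (x (Suc n) - x n))\<^sup>2 \<le> (norm (x n - a))\<^sup>2"
  unfolding x_step by (rule metric_proj_fejer[OF closed_A convex_A, OF i_range i_range assms])

lemma fejer_run:
  assumes "n \<le> m" "\<And>l. n < l \<Longrightarrow> l \<le> m \<Longrightarrow> a \<in> A (i l)"
  shows "(norm (x m - a))\<^sup>2 \<le> (norm (x n - a))\<^sup>2"
  using assms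
proof (induction m rule: dec_induct)
  case (step k)
  have "(norm (x k - a))\<^sup>2 \<le> (norm (x n - a))\<^sup>2" using step by auto
  moreover have "a \<in> A (i (Suc k))" using step by auto
  then have "(norm (x (Suc k) - a))\<^sup>2 \<le> (norm (x k - a))\<^sup>2"
    using fejer[of a k] zero_le_power2[of "norm (x (Suc k) - x k)"] by linarith
  ultimately show ?case by linarith
qed simp

text \<open>The point \<open>x n\<close> has distance zero from itself, and this distance cannot increase.\<close>
lemma constant_run:
  assumes "n \<le> m" "\<And>l. n < l \<Longrightarrow> l \<le> m \<Longrightarrow> x n \<in> A (i l)"
  shows "x m = x n"
proof -
  have "(norm (x m - x n))\<^sup>2 \<le> (norm (x n - x n))\<^sup>2" by (rule fejer_run[OF assms])
  then show ?thesis by simp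
qed

lemma norm_sq_decreasing: "decseq (\<lambda>n. (norm (x n))\<^sup>2)"
  unfolding decseq_Suc_iff
proof
  fix n
  have "0 \<in> A (i (Suc n))" using zero_in_A i_range by blast
  from fejer[OF this] show "(norm (x (Suc n)))\<^sup>2 \<le> (norm (x n))\<^sup>2"
    using zero_le_power2[of "norm (x (Suc n) - x n)"] unfolding diff_zero by linarith
qed

lemma norm_sq_convergent: "\<exists>L. (\<lambda>n. (norm (x n))\<^sup>2) \<longlonglongrightarrow> L"
proof -
  obtain L where "(\<lambda>n. (norm (x n))\<^sup>2) \<longlonglongrightarrow> L"
    by (rule decseq_convergent[OF norm_sq_decreasing, of 0]) auto
  then show ?thesis ..
qed

lemma bounded_x: "bounded (range x)"
proof -
  have "norm (x n) \<le> norm (x 0)" for n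
    using decseqD[OF norm_sq_decreasing, of 0 n] by (simp add: power2_le_iff_abs_le)
  then show ?thesis by (auto simp: bounded_iff)
qed

lemma steps_vanish: "(\<lambda>n. x (Suc n) - x n) \<longlonglongrightarrow> 0"
proof -
  obtain L where L: "(\<lambda>n. (norm (x n))\<^sup>2) \<longlonglongrightarrow> L" using norm_sq_convergent ..
  have lim: "(\<lambda>n. (norm (x n))\<^sup>2 - (norm (x (Suc n)))\<^sup>2) \<longlonglongrightarrow> 0"
    using tendsto_diff[OF L LIMSEQ_Suc[OF L]] by simp
  have le: "(norm (x (Suc n) - x n))\<^sup>2 \<le> (norm (x n))\<^sup>2 - (norm (x (Suc n)))\<^sup>2" for n
  proof -
    have "0 \<in> A (i (Suc n))" using zero_in_A i_range by blast
    from fejer[OF this] show ?thesis by simp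
  qed
  have "(\<lambda>n. (norm (x (Suc n) - x n))\<^sup>2) \<longlonglongrightarrow> 0"
    by (rule Lim_null_comparison[OF _ lim]) (use le in auto)
  from tendsto_real_sqrt[OF this] show ?thesis
    by (simp add: tendsto_norm_zero_iff)
qed

text \<open>
  Each of the finitely many sets that do not contain \<open>w\<close> contains \<open>y k\<close> for only finitely many \<open>k\<close>,
  because the \<open>y k\<close> converge weakly to \<open>w\<close> as well. Stating this for all large \<open>k\<close> allows combining
  several such facts at a single \<open>k\<close>, in place of subsequences on which the index \<open>f k\<close> is constant.
  The three lemmas that follow apply it to the projection that produced \<open>x (m k)\<close>, to the one
  after it, and to the last earlier one onto a different set.
\<close>
lemma eventually_index_in_J_set:
  assumes u: "weakly_converges u w" and d: "(\<lambda>k. y k - u k) \<longlonglongrightarrow> 0"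
    and y: "eventually (\<lambda>k. f k \<in> {1..K} \<and> y k \<in> A (f k)) sequentially"
  shows "eventually (\<lambda>k. f k \<in> J_set A K w) sequentially"
proof -
  have yw: "weakly_converges y w" by (rule weakly_converges_null_perturbation[OF u d])
  have "eventually (\<lambda>k. y k \<notin> A j) sequentially" if "j \<in> {1..K} - J_set A K w" for j
    using weak_limit_in_closed_convex[OF closed_A convex_A yw, of j] that
    by (auto simp: J_set_def frequently_def)
  then have "eventually (\<lambda>k. \<forall>j\<in>{1..K} - J_set A K w. y k \<notin> A j) sequentially"
    by (intro eventually_ball_finite) auto
  with y show ?thesis by eventually_elim blast
qed

lemma eventually_current_index:
  assumes w: "weakly_converges (\<lambda>k. x (m k)) w"
    and m: "eventually (\<lambda>k. 1 \<le> m k) sequentially"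
  shows "eventually (\<lambda>k. i (m k) \<in> J_set A K w) sequentially"
proof (rule eventually_index_in_J_set[OF w])
  show "(\<lambda>k. x (m k) - x (m k)) \<longlonglongrightarrow> 0" by simp
  show "eventually (\<lambda>k. i (m k) \<in> {1..K} \<and> x (m k) \<in> A (i (m k))) sequentially"
    using m
  proof eventually_elim
    case (elim k)
    then show ?case using i_range[of "m k - 1"] x_in_A[of "m k - 1"] by simp
  qed
qed

lemma eventually_next_index:
  assumes w: "weakly_converges (\<lambda>k. x (m k)) w"
    and m: "filterlim m sequentially sequentially"
  shows "eventually (\<lambda>k. i (Suc (m k)) \<in> J_set A K w) sequentially"
proof (rule eventually_index_in_J_set[OF w])
  show "(\<lambda>k. x (Suc (m k)) - x (m k)) \<longlonglongrightarrow> 0"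
    by (rule filterlim_compose[OF steps_vanish m])
  show "eventually (\<lambda>k. i (Suc (m k)) \<in> {1..K} \<and> x (Suc (m k)) \<in> A (i (Suc (m k)))) sequentially"
    by (intro always_eventually allI conjI i_range x_in_A)
qed

lemma eventually_previous_index:
  assumes w: "weakly_converges (\<lambda>k. x (m k)) w"
    and p: "filterlim p sequentially sequentially"
    and run: "eventually (\<lambda>k. x (Suc (p k)) = x (m k)) sequentially"
  shows "eventually (\<lambda>k. i (p k) \<in> J_set A K w) sequentially"
proof (rule eventually_index_in_J_set[OF w])
  have "(\<lambda>k. - (x (Suc (p k)) - x (p k))) \<longlonglongrightarrow> - 0"
    by (intro tendsto_minus filterlim_compose[OF steps_vanish p])
  then show "(\<lambda>k. x (p k) - x (m k)) \<longlonglongrightarrow> 0"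
    using run by (subst tendsto_cong[where g = "\<lambda>k. - (x (Suc (p k)) - x (p k))"])
      (auto elim: eventually_mono)
  have "eventually (\<lambda>k. 1 \<le> p k) sequentially"
    using p by (simp add: filterlim_at_top)
  then show "eventually (\<lambda>k. i (p k) \<in> {1..K} \<and> x (p k) \<in> A (i (p k))) sequentially"
  proof eventually_elim
    case (elim k)
    then show ?case using i_range[of "p k - 1"] x_in_A[of "p k - 1"] by simp
  qed
qed

text \<open>
  Expanding \<open>\<parallel>x (m k) - a\<parallel>\<^sup>2 \<le> \<parallel>x (n k) - a\<parallel>\<^sup>2\<close>, the squares of \<open>\<parallel>x (m k)\<parallel>\<close> and \<open>\<parallel>x (n k)\<parallel>\<close> have the
  same limit and cancel; only the scalar products with \<open>a\<close> remain.
\<close>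
lemma weak_limit_moves_away:
  assumes w: "weakly_converges (\<lambda>k. x (n k)) w" and n: "filterlim n sequentially sequentially"
    and w': "weakly_converges (\<lambda>k. x (m k)) w'" and m: "filterlim m sequentially sequentially"
    and run: "eventually (\<lambda>k. n k \<le> m k \<and> (\<forall>l. n k < l \<and> l \<le> m k \<longrightarrow> a \<in> A (i l))) sequentially"
  shows "0 \<le> (w' - w) \<bullet> a"
proof -
  obtain L where L: "(\<lambda>n. (norm (x n))\<^sup>2) \<longlonglongrightarrow> L" using norm_sq_convergent ..
  have lim: "(\<lambda>k. (norm (x (g k) - a))\<^sup>2) \<longlonglongrightarrow> L - 2 * (v \<bullet> a) + a \<bullet> a"
    if "weakly_converges (\<lambda>k. x (g k)) v" "filterlim g sequentially sequentially" for g v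
  proof -
    have "(\<lambda>k. x (g k) \<bullet> a) \<longlonglongrightarrow> v \<bullet> a"
      using that(1) by (simp add: weakly_converges_def)
    from tendsto_add[OF tendsto_diff[OF filterlim_compose[OF L that(2)]
        tendsto_mult[OF tendsto_const[of 2] this]] tendsto_const[of "a \<bullet> a"]]
    show ?thesis
      by (simp add: power2_norm_eq_inner inner_simps inner_commute algebra_simps)
  qed
  have "eventually (\<lambda>k. (norm (x (m k) - a))\<^sup>2 \<le> (norm (x (n k) - a))\<^sup>2) sequentially"
    using run by eventually_elim (rule fejer_run, blast+)
  from tendsto_le[OF _ lim[OF w n] lim[OF w' m] this]
  show ?thesis by (simp add: inner_simps)
qed

text \<open>
  The index \<open>j\<close> outside \<open>J_set A K w\<close> occurs after every time \<open>r k\<close>. It guarantees both that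
  the index changes after time \<open>r k\<close> and that it leaves \<open>J_set A K w\<close> at some later time.
\<close>
lemma later_weak_limit:
  assumes i_inf: "\<And>k. k \<in> {1..K} \<Longrightarrow> infinite {n. i n = k}"
    and w: "w \<in> partial_weak_limits x"
    and outside: "j \<in> {1..K}" "j \<notin> J_set A K w"
  obtains w' j1 j2 j3 where "w' \<in> partial_weak_limits x"
    "j1 \<in> J_set A K w' \<inter> J_set A K w" "j2 \<in> J_set A K w' \<inter> J_set A K w" "j1 \<noteq> j2"
    "j3 \<in> J_set A K w' - J_set A K w"
    "\<forall>a \<in> (\<Inter>j\<in>J_set A K w. A j). (w' - w) \<bullet> a \<ge> 0"
proof -
  let ?J = "J_set A K w"
  obtain r where r: "strict_mono r" and rw: "weakly_converges (\<lambda>k. x (r k)) w"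
    using w by (auto simp: partial_weak_limits_def comp_def)
  note r_lim = filterlim_subseq[OF r]
  have r_pos: "eventually (\<lambda>k. 1 \<le> r k) sequentially"
    using r_lim by (simp add: filterlim_at_top)
  have current: "eventually (\<lambda>k. i (r k) \<in> ?J) sequentially"
    by (rule eventually_current_index[OF rw r_pos])
  \<comment> \<open>The sequence rests at \<open>x (r k)\<close> until the index changes at time \<open>q k\<close>, so \<open>w\<close> is also the weak
    limit of \<open>x (q k - 1)\<close>, and the index at time \<open>q k\<close> still belongs to \<open>J_set A K w\<close>.\<close>
  define q where "q k = (LEAST q. r k < q \<and> i q \<noteq> i (r k))" for k
  have q: "r k < q k" "i (q k) \<noteq> i (r k)"
    and q_least: "\<And>l. r k < l \<Longrightarrow> l < q k \<Longrightarrow> i l = i (r k)" if "i (r k) \<in> ?J" for k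
  proof -
    obtain l where "r k < l" "i l = j"
      using i_inf[OF outside(1)] unfolding infinite_nat_iff_unbounded by blast
    then have "r k < l \<and> i l \<noteq> i (r k)" using outside(2) that by auto
    from LeastI[of "\<lambda>q. r k < q \<and> i q \<noteq> i (r k)", OF this]
    show "r k < q k" "i (q k) \<noteq> i (r k)" by (auto simp: q_def)
    show "i l = i (r k)" if "r k < l" "l < q k" for l
      using not_less_Least[of l "\<lambda>q. r k < q \<and> i q \<noteq> i (r k)"] that by (auto simp: q_def)
  qed
  have wait: "eventually (\<lambda>k. x (q k - 1) = x (r k)) sequentially"
    using current r_pos
  proof eventually_elim
    case (elim k)
    have "x (r k) \<in> A (i (r k))" using x_in_A[of "r k - 1"] elim by simp
    then show ?case using q[OF elim(1)] q_least[OF elim(1)] elim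
      by (intro constant_run) auto
  qed
  have "eventually (\<lambda>k. i (Suc (q k - 1)) \<in> ?J) sequentially"
  proof (rule eventually_next_index)
    have "(\<lambda>k. x (q k - 1) - x (r k)) \<longlonglongrightarrow> 0"
      by (rule tendsto_eventually) (use wait in \<open>auto elim: eventually_mono\<close>)
    then show "weakly_converges (\<lambda>k. x (q k - 1)) w"
      by (rule weakly_converges_null_perturbation[OF rw])
    have "eventually (\<lambda>k. r k \<le> q k - 1) sequentially"
      using current by eventually_elim (use q in force)
    then show "filterlim (\<lambda>k. q k - 1) sequentially sequentially"
      by (rule filterlim_at_top_mono[OF r_lim])
  qed
  with current have "eventually (\<lambda>k. \<exists>p m. r k \<le> p \<and> p < m \<and> (\<forall>l. r k \<le> l \<and> l \<le> m \<longrightarrow> i l \<in> ?J)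
      \<and> i (Suc m) \<notin> ?J \<and> i p \<noteq> i m \<and> x m = x (Suc p)) sequentially"
  proof eventually_elim
    case (elim k)
    note q' = q[OF elim(1)] q_least[OF elim(1)]
    obtain t where t: "q k < t" "i t = j"
      using i_inf[OF outside(1)] unfolding infinite_nat_iff_unbounded by blast
    have q_in: "i (q k) \<in> ?J" using elim(2) q'(1) by simp
    have stay: "i l \<in> ?J" if "r k \<le> l" "l \<le> q k" for l
    proof (cases "l = r k \<or> l = q k")
      case True
      then show ?thesis using elim(1) q_in by auto
    next
      case False
      then have "r k < l" "l < q k" using that by auto
      then show ?thesis using q'(3)[of l] elim(1) by simp
    qed
    have "i t \<notin> ?J" using t(2) outside(2) by simp
    from last_change_before_leaving[OF q'(1,2) stay t(1) this]
    obtain p m where pm: "r k \<le> p" "p < m" "\<forall>l. r k \<le> l \<and> l \<le> m \<longrightarrow> i l \<in> ?J"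
      "i (Suc m) \<notin> ?J" "i p \<noteq> i m" and run: "\<forall>l. p < l \<and> l \<le> m \<longrightarrow> i l = i m" .
    \<comment> \<open>After time \<open>p\<close> one and the same projection is repeated.\<close>
    have "x m = x (Suc p)"
    proof (rule constant_run)
      show "x (Suc p) \<in> A (i l)" if "Suc p < l" "l \<le> m" for l
      proof -
        have "i (Suc p) = i m" using spec[OF run, of "Suc p"] pm(2) by simp
        moreover have "i l = i m" using spec[OF run, of l] that by simp
        ultimately show ?thesis using x_in_A[of p] by metis
      qed
    qed (use pm in simp)
    with pm show ?case by blast
  qed
  then obtain p m where pm: "eventually (\<lambda>k. r k \<le> p k \<and> p k < m k
      \<and> (\<forall>l. r k \<le> l \<and> l \<le> m k \<longrightarrow> i l \<in> ?J) \<and> i (Suc (m k)) \<notin> ?J \<and> i (p k) \<noteq> i (m k)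
      \<and> x (m k) = x (Suc (p k))) sequentially"
    unfolding eventually_ex by blast
  have p_lim: "filterlim p sequentially sequentially"
  proof (rule filterlim_at_top_mono[OF r_lim])
    show "eventually (\<lambda>k. r k \<le> p k) sequentially"
      using pm by eventually_elim simp
  qed
  have m_lim: "filterlim m sequentially sequentially"
  proof (rule filterlim_at_top_mono[OF p_lim])
    show "eventually (\<lambda>k. p k \<le> m k) sequentially"
      using pm by eventually_elim simp
  qed
  obtain s w' where s: "strict_mono s" and w': "weakly_converges (\<lambda>k. x (m (s k))) w'"
    and W: "w' \<in> partial_weak_limits x"
    by (rule partial_weak_limit_along[OF bounded_x m_lim])
  note s_lim = filterlim_subseq[OF s]
  note ms_lim = filterlim_compose[OF m_lim s_lim]
    and ps_lim = filterlim_compose[OF p_lim s_lim]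
    and rs_lim = filterlim_compose[OF r_lim s_lim]
  note pms = eventually_compose_filterlim[OF pm s_lim]
  have "eventually (\<lambda>k. x (Suc (p (s k))) = x (m (s k))) sequentially"
    using pms by eventually_elim simp
  from eventually_previous_index[OF w' ps_lim this]
  have "eventually (\<lambda>k. i (p (s k)) \<in> J_set A K w') sequentially" .
  moreover have "eventually (\<lambda>k. i (m (s k)) \<in> J_set A K w') sequentially"
    using ms_lim by (intro eventually_current_index[OF w']) (simp add: filterlim_at_top)
  moreover have "eventually (\<lambda>k. i (Suc (m (s k))) \<in> J_set A K w') sequentially"
    by (rule eventually_next_index[OF w' ms_lim])
  ultimately have "eventually (\<lambda>k. i (p (s k)) \<in> J_set A K w' \<inter> ?J \<and> i (m (s k)) \<in> J_set A K w' \<inter> ?J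
      \<and> i (p (s k)) \<noteq> i (m (s k)) \<and> i (Suc (m (s k))) \<in> J_set A K w' - ?J) sequentially"
    using pms by eventually_elim auto
  then obtain k where k: "i (p (s k)) \<in> J_set A K w' \<inter> ?J" "i (m (s k)) \<in> J_set A K w' \<inter> ?J"
      "i (p (s k)) \<noteq> i (m (s k))" "i (Suc (m (s k))) \<in> J_set A K w' - ?J"
    using eventually_happens'[OF sequentially_bot] by blast
  have dir: "\<forall>a \<in> (\<Inter>j\<in>?J. A j). (w' - w) \<bullet> a \<ge> 0"
  proof (rule ballI, rule weak_limit_moves_away[OF _ rs_lim w' ms_lim])
    fix a assume a: "a \<in> (\<Inter>j\<in>?J. A j)"
    show "weakly_converges (\<lambda>k. x (r (s k))) w"
      by (rule weakly_converges_subseq[OF rw s_lim])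
    show "eventually (\<lambda>k. r (s k) \<le> m (s k)
        \<and> (\<forall>l. r (s k) < l \<and> l \<le> m (s k) \<longrightarrow> a \<in> A (i l))) sequentially"
      using pms by eventually_elim (use a in auto)
  qed
  show ?thesis by (rule that[OF W k dir])
qed

end

section \<open>From a nonzero weak limit to a longer one\<close>

theorem theorem1:
  fixes A :: "nat \<Rightarrow> 'h::{real_inner, complete_space} set"
    and K :: nat
    and i :: "nat \<Rightarrow> nat"
    and x :: "nat \<Rightarrow> 'h"
    and x0 :: 'h
    and W :: "'h set"
    and J :: "'h \<Rightarrow> nat set"
  assumes K: "K \<ge> 2"
    and closed_A: "\<And>k. k \<in> {1..K} \<Longrightarrow> closed (A k)"
    and convex_A: "\<And>k. k \<in> {1..K} \<Longrightarrow> convex (A k)"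
    and Int_A: "(\<Inter>k\<in>{1..K}. A k) = {0}"
    and i_range: "\<And>n. n \<ge> 1 \<Longrightarrow> i n \<in> {1..K}"
    and i_inf: "\<And>k. k \<in> {1..K} \<Longrightarrow> infinite {n. n \<ge> 1 \<and> i n = k}"
    and x_0: "x 0 = x0"
    and x_step: "\<And>n. n \<ge> 1 \<Longrightarrow> x n = metric_proj (A (i n)) (x (n - 1))"
    and W_def: "W = partial_weak_limits x"
    and J_def: "J = J_set A K"
  shows "\<forall>w\<in>W. w \<noteq> 0 \<longrightarrow>
    (\<exists>w'\<in>W. w' \<noteq> w
      \<and> card (J w' - J w) \<ge> 1
      \<and> card (J w' \<inter> J w) \<ge> 2
      \<and> card (J w') \<ge> 3
      \<and> (\<forall>a \<in> (\<Inter>j\<in>J w. A j). (w' - w) \<bullet> a \<ge> 0)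
      \<and> (norm w')\<^sup>2 \<ge> (norm w)\<^sup>2 + (norm (w - w'))\<^sup>2
      \<and> norm w' > norm w)"
proof (intro ballI impI)
  fix w assume "w \<in> W" "w \<noteq> 0"
  have zero: "0 \<in> A k" if "k \<in> {1..K}" for k using Int_A that by blast
  interpret projection_sequence A K i x
  proof
    show "closed (A k)" "convex (A k)" "0 \<in> A k" if "k \<in> {1..K}" for k
      using closed_A convex_A zero that by blast+
    show "i (Suc n) \<in> {1..K}" for n using i_range[of "Suc n"] by simp
    show "x (Suc n) = metric_proj (A (i (Suc n))) (x n)" for n using x_step[of "Suc n"] by simp
  qed
  have inf: "infinite {n. i n = k}" if "k \<in> {1..K}" for k
    by (rule infinite_super[OF _ i_inf[OF that]]) auto
  have "w \<notin> (\<Inter>k\<in>{1..K}. A k)" using \<open>w \<noteq> 0\<close> Int_A by blast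
  then obtain j where "j \<in> {1..K}" "j \<notin> J w" by (auto simp: J_def J_set_def)
  obtain w' j1 j2 j3 where w': "w' \<in> W"
    and j: "j1 \<in> J w' \<inter> J w" "j2 \<in> J w' \<inter> J w" "j1 \<noteq> j2" "j3 \<in> J w' - J w"
    and dir: "\<forall>a \<in> (\<Inter>j\<in>J w. A j). (w' - w) \<bullet> a \<ge> 0"
    unfolding W_def J_def
    by (rule later_weak_limit[OF inf \<open>w \<in> W\<close>[unfolded W_def] \<open>j \<in> {1..K}\<close>
        \<open>j \<notin> J w\<close>[unfolded J_def]])
  have "w' \<noteq> w" using j(4) by blast
  have fin: "finite (J w')" by (simp add: J_def J_set_def)
  have card1: "card (J w' - J w) \<ge> 1"
    using card_mono[of "J w' - J w" "{j3}"] fin j(4) by simp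
  have card2: "card (J w' \<inter> J w) \<ge> 2"
    using card_mono[of "J w' \<inter> J w" "{j1, j2}"] fin j by simp
  have card3: "card (J w') \<ge> 3"
    using card1 card2 card_Int_Diff[OF fin, of "J w"] by linarith
  have "w \<in> (\<Inter>j\<in>J w. A j)" by (simp add: J_def J_set_def)
  from bspec[OF dir this] have pyth: "(norm w')\<^sup>2 \<ge> (norm w)\<^sup>2 + (norm (w - w'))\<^sup>2"
    by (simp add: power2_norm_eq_inner inner_simps inner_commute)
  moreover have "0 < (norm (w - w'))\<^sup>2" using \<open>w' \<noteq> w\<close> by simp
  ultimately have "(norm w)\<^sup>2 < (norm w')\<^sup>2" by linarith
  then have "norm w < norm w'" by (rule power2_less_imp_less) simp
  then show "\<exists>w'\<in>W. w' \<noteq> w \<and> card (J w' - J w) \<ge> 1 \<and> card (J w' \<inter> J w) \<ge> 2 \<and> card (J w') \<ge> 3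
      \<and> (\<forall>a \<in> (\<Inter>j\<in>J w. A j). (w' - w) \<bullet> a \<ge> 0)
      \<and> (norm w')\<^sup>2 \<ge> (norm w)\<^sup>2 + (norm (w - w'))\<^sup>2 \<and> norm w' > norm w"
    using w' \<open>w' \<noteq> w\<close> card1 card2 card3 dir pyth by blast
qed

end
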